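(* Let $(u_j^n,y_j^n)_{0\le j\le N+1,\ n\ge0}$ be the discrete solution generated by the following explicit finite-difference scheme. For all $n\ge 0$: $u_0^n=u_{N+1}^n=y_0^n=y_{N+1}^n=0$; and for all $n\ge0$ and $j=1,\dots,N$, $$\frac{u_j^{n+1}-2u_j^n+u_j^{n-1}}{\Delta t^2}-\frac{u_{j+1}^n-2u_j^n+u_{j-1}^n}{\Delta x^2}+b_j\frac{y_j^{n+1}-y_j^{n-1}}{2\Delta t}+a_j\mu_1\frac{u_j^{n+1}-u_j^{n-1}}{2\Delta t}+a_j\mu_2D_j^n=0,$$ $$\frac{y_j^{n+1}-2y_j^n+y_j^{n-1}}{\Delta t^2}-\frac{y_{j+1}^n-2y_j^n+y_{j-1}^n}{\Delta x^2}-b_j\frac{u_j^{n+1}-u_j^{n-1}}{2\Delta t}=0,$$ where $D_j^n=f_0(x_j,(n-I)\Delta t)$ if $0\le n\le I$ and $D_j^n=\dfrac{u_j^{n-I+1}-u_j^{n-I-1}}{2\Delta t}$ if $n>I$, and where, for $j=1,\dots,N$, $u_j^0=u_0(x_j)$, $y_j^0=y_0(x_j)$, and at $n=0$ the ghost values are $u_j^{-1}=u_j^1-2\Delta t\,u_1(x_j)$, $y_j^{-1}=y_j^1-2\Delta t\,y_1(x_j)$. Define the discrete energy, for $n\ge0$, by $E^n=E_{k,u}^n+E_{p,u}^n+E_{k,y}^n+E_{p,y}^n+E_{d,u}^n$, where $$E_{k,u}^n=\frac12\sum_{j=1}^N\left(\frac{u_j^{n+1}-u_j^n}{\Delta t}\right)^2,\qquad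 E_{p,u}^n=\frac12\sum_{j=0}^N\left(\frac{u_{j+1}^n-u_j^n}{\Delta x}\right)\left(\frac{u_{j+1}^{n+1}-u_j^{n+1}}{\Delta x}\right),$$ $$E_{k,y}^n=\frac12\sum_{j=1}^N\left(\frac{y_j^{n+1}-y_j^n}{\Delta t}\right)^2,\qquad E_{p,y}^n=\frac12\sum_{j=0}^N\left(\frac{y_{j+1}^n-y_j^n}{\Delta x}\right)\left(\frac{y_{j+1}^{n+1}-y_j^{n+1}}{\Delta x}\right),$$ $$E_{d,u}^n=\begin{cases}\dfrac{\xi\tau^{-1}}2\displaystyle\sum_{j=1}^Na_j\left(\sum_{k=n+1}^I\Delta t\,f_0^2(x_j,(k-I)\Delta t)+\sum_{k=1}^n\Delta t\left(\frac{u_j^{k+1}-u_j^{k-1}}{2\Delta t}\right)^2\right),&n<I,\\[2ex]\dfrac{\xi\tau^{-1}}2\displaystyle\sum_{j=1}^Na_j\Delta t\sum_{k=n-I+1}^n\left(\frac{u_j^{k+1}-u_j^{k-1}}{2\Delta t}\right)^2,&n\ge I.\end{cases}$$ If $\mu_2<\mu_1$ and $\tau\mu_2<\xi<\tau(2\mu_1-\mu_2)$, then the discrete energy is nonincreasing: $E^n\le E^{n-1}$ for all $n\ge1$.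
   Context: The scheme discretizes, on $\Omega=(0,1)$, the system $$u_{tt}-u_{xx}+b\,y_t+a[\mu_1u_t(x,t)+\mu_2u_t(x,t-\tau)]=0,\qquad y_{tt}-y_{xx}-b\,u_t=0,$$ with homogeneous Dirichlet conditions at $x=0,1$, initial data $(u,u_t,y,y_t)(\cdot,0)=(u_0,u_1,y_0,y_1)$ and $u_t=f_0$ on $(0,1)\times(-\tau,0)$. Here $\mu_1,\mu_2>0$, $\tau>0$ is the delay, and $\xi$ is a positive number. The functions $a\in L^\infty(0,1)$, $a\ge0$, and $b\in W^{1,\infty}(0,1)$ are real-valued; as standing assumptions of the paper, $a>a_0>0$ a.e. on a nonempty open set $\omega\subset(0,1)$ satisfying the geometric control condition (every ray of geometrical optics starting in $\Omega$ at $t=0$ enters $\omega$ in finite time), and $b\neq0$ on the closure of a nonempty open set $\omega_b\subset\omega$. Grid: $N$ is the number of interior nodes, $x_j=j\Delta x$ for $j=0,\dots,N+1$ with $x_0=0$, $x_{N+1}=1$ (so $\Delta x=1/(N+1)$); $\Delta t>0$ is the time step, $t^n=n\Delta t$, and $\tau=I\Delta t$ with $I\ge1$ an integer. One sets $a_j=a(x_j)\ge0$ and $b_j=b(x_j)$. The functions $a,b,u_0,u_1,y_0,y_1,f_0$ are assumed to have well-defined point values at the grid points used. *)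

theory Defs
  imports "HOL-Analysis.Analysis"
begin

section \<open>Function spaces on the unit interval\<close>

abbreviation Omega :: "real set" where
  "Omega \<equiv> {0<..<1}"

definition L_infty :: "(real \<Rightarrow> real) \<Rightarrow> bool" where
  "L_infty f \<longleftrightarrow> f \<in> borel_measurable (lebesgue_on Omega) \<and>
     (\<exists>C. AE x in lebesgue_on Omega. \<bar>f x\<bar> \<le> C)"

definition test_function :: "(real \<Rightarrow> real) \<Rightarrow> bool" where
  "test_function \<phi> \<longleftrightarrow> (\<forall>k x. (deriv ^^ k) \<phi> field_differentiable at x) \<and>
     (\<exists>K. compact K \<and> K \<subseteq> Omega \<and> (\<forall>x. x \<notin> K \<longrightarrow> \<phi> x = 0))"

definition weak_derivative :: "(real \<Rightarrow> real) \<Rightarrow> (real \<Rightarrow> real) \<Rightarrow> bool" where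
  "weak_derivative f g \<longleftrightarrow> (\<forall>\<phi>. test_function \<phi> \<longrightarrow>
     (LINT x|lebesgue_on Omega. f x * deriv \<phi> x) = - (LINT x|lebesgue_on Omega. g x * \<phi> x))"

definition W1_infty :: "(real \<Rightarrow> real) \<Rightarrow> bool" where
  "W1_infty f \<longleftrightarrow> L_infty f \<and> (\<exists>g. L_infty g \<and> weak_derivative f g)"

section \<open>Geometric control\<close>

text \<open>Rays of the one-dimensional wave operator: unit-speed straight motion while inside
  the interval. The last clause excludes sticking to the boundary, so that a ray hitting an
  end point is reflected back at once.\<close>

definition optical_ray :: "(real \<Rightarrow> real) \<Rightarrow> bool" where
  "optical_ray X \<longleftrightarrow>
     continuous_on {0..} X \<and> X 0 \<in> Omega \<and> (\<forall>t\<ge>0. X t \<in> {0..1}) \<and>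
     (\<forall>s t. 0 \<le> s \<and> s < t \<and> X ` {s<..<t} \<subseteq> Omega \<longrightarrow>
        (\<exists>c\<in>{-1, 1}. \<forall>r\<in>{s..t}. X r = X s + c * (r - s))) \<and>
     (\<forall>t\<ge>0. X t \<in> {0, 1} \<longrightarrow>
        (\<exists>e>0. \<forall>r\<ge>0. r \<noteq> t \<and> \<bar>r - t\<bar> < e \<longrightarrow> X r \<in> Omega))"

definition geometric_control :: "real set \<Rightarrow> bool" where
  "geometric_control \<omega> \<longleftrightarrow> (\<forall>X. optical_ray X \<longrightarrow> (\<exists>t\<ge>0. X t \<in> \<omega>))"

section \<open>The finite-difference scheme\<close>

text \<open>Grid functions are written \<open>w j n\<close> (space index \<open>j\<close>, time index \<open>n\<close>). Time indices are
  integers, so that the ghost level \<open>n = -1\<close> is available and no subtraction is truncated.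
  Values at \<open>n < -1\<close> are never used.\<close>

definition mesh :: "nat \<Rightarrow> real" where
  "mesh N = 1 / (real N + 1)"

definition node :: "nat \<Rightarrow> nat \<Rightarrow> real" where
  "node N j = real j * mesh N"

definition centered_dt :: "real \<Rightarrow> (nat \<Rightarrow> int \<Rightarrow> real) \<Rightarrow> nat \<Rightarrow> int \<Rightarrow> real" where
  "centered_dt dt w j n = (w j (n + 1) - w j (n - 1)) / (2 * dt)"

definition discrete_wave :: "real \<Rightarrow> real \<Rightarrow> (nat \<Rightarrow> int \<Rightarrow> real) \<Rightarrow> nat \<Rightarrow> int \<Rightarrow> real" where
  "discrete_wave dx dt w j n =
     (w j (n + 1) - 2 * w j n + w j (n - 1)) / dt\<^sup>2
     - (w (j + 1) n - 2 * w j n + w (j - 1) n) / dx\<^sup>2"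

definition delay_term ::
  "nat \<Rightarrow> nat \<Rightarrow> real \<Rightarrow> (real \<Rightarrow> real \<Rightarrow> real) \<Rightarrow> (nat \<Rightarrow> int \<Rightarrow> real) \<Rightarrow> nat \<Rightarrow> int \<Rightarrow> real" where
  "delay_term N I dt f0 u j n =
     (if n \<le> int I then f0 (node N j) (of_int (n - int I) * dt)
      else centered_dt dt u j (n - int I))"

definition discrete_solution ::
  "nat \<Rightarrow> nat \<Rightarrow> real \<Rightarrow> real \<Rightarrow> real \<Rightarrow> (real \<Rightarrow> real) \<Rightarrow> (real \<Rightarrow> real) \<Rightarrow>
   (real \<Rightarrow> real) \<Rightarrow> (real \<Rightarrow> real) \<Rightarrow> (real \<Rightarrow> real) \<Rightarrow> (real \<Rightarrow> real) \<Rightarrow> (real \<Rightarrow> real \<Rightarrow> real) \<Rightarrow>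
   (nat \<Rightarrow> int \<Rightarrow> real) \<Rightarrow> (nat \<Rightarrow> int \<Rightarrow> real) \<Rightarrow> bool" where
  "discrete_solution N I dt \<mu>1 \<mu>2 a b u0 u1 y0 y1 f0 u y \<longleftrightarrow>
     (\<forall>n\<ge>0. u 0 n = 0 \<and> u (N + 1) n = 0 \<and> y 0 n = 0 \<and> y (N + 1) n = 0) \<and>
     (\<forall>n\<ge>0. \<forall>j\<in>{1..N}.
        discrete_wave (mesh N) dt u j n
          + b (node N j) * centered_dt dt y j n
          + a (node N j) * \<mu>1 * centered_dt dt u j n
          + a (node N j) * \<mu>2 * delay_term N I dt f0 u j n = 0 \<and>
        discrete_wave (mesh N) dt y j n
          - b (node N j) * centered_dt dt u j n = 0) \<and>
     (\<forall>j\<in>{1..N}.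
        u j 0 = u0 (node N j) \<and> y j 0 = y0 (node N j) \<and>
        u j (-1) = u j 1 - 2 * dt * u1 (node N j) \<and>
        y j (-1) = y j 1 - 2 * dt * y1 (node N j))"

section \<open>The discrete energy\<close>

definition kinetic_energy :: "nat \<Rightarrow> real \<Rightarrow> (nat \<Rightarrow> int \<Rightarrow> real) \<Rightarrow> int \<Rightarrow> real" where
  "kinetic_energy N dt w n = 1/2 * (\<Sum>j=1..N. ((w j (n + 1) - w j n) / dt)\<^sup>2)"

definition potential_energy :: "nat \<Rightarrow> (nat \<Rightarrow> int \<Rightarrow> real) \<Rightarrow> int \<Rightarrow> real" where
  "potential_energy N w n = 1/2 * (\<Sum>j=0..N.
     ((w (j + 1) n - w j n) / mesh N) * ((w (j + 1) (n + 1) - w j (n + 1)) / mesh N))"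

definition delay_energy ::
  "nat \<Rightarrow> nat \<Rightarrow> real \<Rightarrow> real \<Rightarrow> real \<Rightarrow> (real \<Rightarrow> real) \<Rightarrow> (real \<Rightarrow> real \<Rightarrow> real) \<Rightarrow>
   (nat \<Rightarrow> int \<Rightarrow> real) \<Rightarrow> int \<Rightarrow> real" where
  "delay_energy N I dt \<tau> \<xi> a f0 u n =
     (if n < int I then
        \<xi> * inverse \<tau> / 2 * (\<Sum>j=1..N. a (node N j) *
          ((\<Sum>k=n+1..int I. dt * (f0 (node N j) (of_int (k - int I) * dt))\<^sup>2)
           + (\<Sum>k=1..n. dt * (centered_dt dt u j k)\<^sup>2)))
      else
        \<xi> * inverse \<tau> / 2 * (\<Sum>j=1..N. a (node N j) * dt *
          (\<Sum>k=n-int I+1..n. (centered_dt dt u j k)\<^sup>2)))"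

definition discrete_energy ::
  "nat \<Rightarrow> nat \<Rightarrow> real \<Rightarrow> real \<Rightarrow> real \<Rightarrow> (real \<Rightarrow> real) \<Rightarrow> (real \<Rightarrow> real \<Rightarrow> real) \<Rightarrow>
   (nat \<Rightarrow> int \<Rightarrow> real) \<Rightarrow> (nat \<Rightarrow> int \<Rightarrow> real) \<Rightarrow> int \<Rightarrow> real" where
  "discrete_energy N I dt \<tau> \<xi> a f0 u y n =
     kinetic_energy N dt u n + potential_energy N u n
     + kinetic_energy N dt y n + potential_energy N y n
     + delay_energy N I dt \<tau> \<xi> a f0 u n"

end

(* Summation by parts turns dt times the centered velocity into the multiplier that converts the
   discrete wave operator into an energy increment. The coupling terms of the two equations cancel,
   and the delay energy telescopes, so that with v the centered velocity and D the delayed one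
   E^n - E^(n-1) is the weighted sum of dt a_j times the quadratic form
   -\<mu>1 v^2 - \<mu>2 v D + \<xi>/(2\<tau>) (v^2 - D^2), which is nonpositive for \<mu>2 \<le> \<xi>/\<tau> \<le> 2\<mu>1 - \<mu>2. *)
theory Submission
  imports Defs
begin

text \<open>Discrete Green formula: extending the grid by one cell moves the right boundary term
  from \<open>N + 1\<close> to \<open>N + 2\<close> and leaves behind one more second difference.
  Both boundary terms are kept, so \<open>p\<close> is arbitrary here.\<close>

lemma sum_by_parts_second_difference:
  fixes w p :: "nat \<Rightarrow> 'a::comm_ring_1"
  shows "(\<Sum>j=0..N. (w (j + 1) - w j) * (p (j + 1) - p j)) =
    (w (N + 1) - w N) * p (N + 1) - (w 1 - w 0) * p 0
    - (\<Sum>j=1..N. (w (j + 1) - 2 * w j + w (j - 1)) * p j)"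
  by (induction N) (simp_all add: algebra_simps)

text \<open>The multiplier identity for a single wave component. The hypotheses \<open>left\<close>
  and \<open>right\<close> say exactly that the centered velocity vanishes at the two end nodes,
  which removes the boundary terms.\<close>

lemma wave_energy_increment:
  fixes w :: "nat \<Rightarrow> int \<Rightarrow> real"
  assumes "dt \<noteq> 0"
    and left: "w 0 (n + 1) = w 0 (n - 1)"
    and right: "w (N + 1) (n + 1) = w (N + 1) (n - 1)"
  shows "kinetic_energy N dt w n + potential_energy N w n
      - (kinetic_energy N dt w (n - 1) + potential_energy N w (n - 1))
    = dt * (\<Sum>j=1..N. discrete_wave (mesh N) dt w j n * centered_dt dt w j n)"
proof -
  \<comment> \<open>This is \<open>2 * dt\<close> times the centered velocity, so no division by
    \<open>dt\<close> enters the summation by parts.\<close>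
  define p where "p j = w j (n + 1) - w j (n - 1)" for j
  \<comment> \<open>Termwise this is \<open>(r - s)\<^sup>2 - (s - t)\<^sup>2 = (r - 2 * s + t) * (r
    - t)\<close>.\<close>
  have kin: "kinetic_energy N dt w n - kinetic_energy N dt w (n - 1)
      = (\<Sum>j=1..N. (w j (n + 1) - 2 * w j n + w j (n - 1)) / dt\<^sup>2 * (p j / 2))"
    unfolding kinetic_energy_def sum_distrib_left sum_subtractf[symmetric]
    by (rule sum.cong) (use assms(1) in \<open>simp_all add: p_def field_simps power2_eq_square\<close>)
  \<comment> \<open>Consecutive potential energies share the gradient at level \<open>n\<close>;
    only the other factor changes, from level \<open>n - 1\<close> to \<open>n + 1\<close>, and its
    change is the gradient of \<open>p\<close>.\<close>
  have "potential_energy N w n - potential_energy N w (n - 1)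
      = 1 / (2 * (mesh N)\<^sup>2) * (\<Sum>j=0..N. (w (j + 1) n - w j n) * (p (j + 1) - p j))"
    unfolding potential_energy_def sum_distrib_left sum_subtractf[symmetric]
    by (rule sum.cong) (simp_all add: p_def mesh_def field_simps power2_eq_square)
  also have "\<dots> = - (\<Sum>j=1..N. (w (j + 1) n - 2 * w j n + w (j - 1) n) / (mesh N)\<^sup>2 * (p j / 2))"
    unfolding sum_by_parts_second_difference[of "\<lambda>j. w j n" p N]
    using left right by (simp add: p_def sum_distrib_left sum_negf mult.commute)
  finally have pot: "potential_energy N w n - potential_energy N w (n - 1)
      = - (\<Sum>j=1..N. (w (j + 1) n - 2 * w j n + w (j - 1) n) / (mesh N)\<^sup>2 * (p j / 2))" .
  have "dt * (\<Sum>j=1..N. discrete_wave (mesh N) dt w j n * centered_dt dt w j n)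
      = (\<Sum>j=1..N. (w j (n + 1) - 2 * w j n + w j (n - 1)) / dt\<^sup>2 * (p j / 2)
          - (w (j + 1) n - 2 * w j n + w (j - 1) n) / (mesh N)\<^sup>2 * (p j / 2))"
    unfolding sum_distrib_left
  proof (rule sum.cong)
    fix j
    have "dt * centered_dt dt w j n = p j / 2"
      using assms(1) by (simp add: centered_dt_def p_def)
    then show "dt * (discrete_wave (mesh N) dt w j n * centered_dt dt w j n)
        = (w j (n + 1) - 2 * w j n + w j (n - 1)) / dt\<^sup>2 * (p j / 2)
          - (w (j + 1) n - 2 * w j n + w (j - 1) n) / (mesh N)\<^sup>2 * (p j / 2)"
      unfolding discrete_wave_def mult.left_commute[of dt] by (simp only: left_diff_distrib)
  qed simp
  then show ?thesis
    using kin pot by (simp add: sum_subtractf)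
qed

lemma sum_int_atLeastAtMost_head:
  fixes f :: "int \<Rightarrow> 'a::comm_monoid_add"
  assumes "m \<le> n"
  shows "sum f {m..n} = f m + sum f {m + 1..n}"
proof -
  have "{m..n} = insert m {m + 1..n}"
    using assms by auto
  then show ?thesis by simp
qed

lemma sum_int_atLeastAtMost_last:
  fixes f :: "int \<Rightarrow> 'a::comm_monoid_add"
  assumes "m \<le> n"
  shows "sum f {m..n} = sum f {m..n - 1} + f n"
proof -
  have "{m..n} = insert n {m..n - 1}"
    using assms by auto
  then show ?thesis by (simp add: add.commute)
qed

text \<open>The delay energy sums squares over a window of \<open>I\<close> time levels ending at
  \<open>n\<close>. A step forward adds the squared velocity at \<open>n\<close> and drops the
  oldest entry, which is the square of the delay term.\<close>

lemma delay_energy_increment: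
  fixes n :: int
  assumes "n \<ge> 1"
  shows "delay_energy N I dt \<tau> \<xi> a f0 u n - delay_energy N I dt \<tau> \<xi> a f0 u (n - 1)
    = \<xi> / (2 * \<tau>) * dt *
      (\<Sum>j=1..N. a (node N j) * ((centered_dt dt u j n)\<^sup>2 - (delay_term N I dt f0 u j n)\<^sup>2))"
proof -
  define v where "v j k = (centered_dt dt u j k)\<^sup>2" for j k
  define F where "F j k = (f0 (node N j) (of_int (k - int I) * dt))\<^sup>2" for j k
  \<comment> \<open>The window at node \<open>j\<close>, stripped of the weight common to both
    branches of the energy.\<close>
  define H where "H n j = (if n < int I then (\<Sum>k=n+1..int I. F j k) + (\<Sum>k=1..n. v j k)
      else (\<Sum>k=n-int I+1..n. v j k))" for n j
  have energy: "delay_energy N I dt \<tau> \<xi> a f0 u m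
      = \<xi> / (2 * \<tau>) * dt * (\<Sum>j=1..N. a (node N j) * H m j)" for m
  proof -
    have coeff: "\<xi> * inverse \<tau> / 2 = \<xi> / (2 * \<tau>)"
      by (simp add: field_simps)
    have pull: "x * (\<Sum>j=1..N. g j * (dt * h j)) = x * (dt * (\<Sum>j=1..N. g j * h j))"
      for x :: real and g h :: "nat \<Rightarrow> real"
      by (simp add: sum_distrib_left mult.left_commute)
    show ?thesis
      unfolding delay_energy_def H_def v_def F_def coeff
      by (cases "m < int I")
        (simp_all only: if_True if_False mult.assoc sum_distrib_left[symmetric]
          distrib_left[symmetric] pull)
  qed
  have step: "H n j - H (n - 1) j = v j n - (delay_term N I dt f0 u j n)\<^sup>2" for j
  proof -
    consider "n < int I" | "n = int I" | "n > int I" by linarith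
    then show ?thesis
    proof cases
      case 1
      then show ?thesis
        using assms sum_int_atLeastAtMost_head[of n "int I" "F j"]
          sum_int_atLeastAtMost_last[of 1 n "v j"]
        by (simp add: H_def delay_term_def F_def)
    next
      \<comment> \<open>Here the energies at \<open>n\<close> and \<open>n - 1\<close> lie in
        different branches. The dropped entry is the last prescribed value, at time 0, which the
        delay term also uses at \<open>n = int I\<close>.\<close>
      case 2
      then show ?thesis
        using assms sum_int_atLeastAtMost_last[of 1 n "v j"]
        by (simp add: H_def delay_term_def F_def)
    next
      \<comment> \<open>Both windows lie in \<open>{n - int I..n}\<close>: removing its first level
        gives the window at \<open>n\<close>, removing its last gives the one at
        \<open>n - 1\<close>.\<close>
      case 3
      then show ?thesis
        using sum_int_atLeastAtMost_last[of "n - int I" n "v j"]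
          sum_int_atLeastAtMost_head[of "n - int I" n "v j"]
        by (simp add: H_def delay_term_def v_def algebra_simps)
    qed
  qed
  have "delay_energy N I dt \<tau> \<xi> a f0 u n - delay_energy N I dt \<tau> \<xi> a f0 u (n - 1)
      = \<xi> / (2 * \<tau>) * dt * (\<Sum>j=1..N. a (node N j) * (H n j - H (n - 1) j))"
    unfolding energy by (simp only: right_diff_distrib sum_subtractf)
  then show ?thesis
    by (simp only: step v_def)
qed

text \<open>Writing \<open>- 2 * v * d = v\<^sup>2 + d\<^sup>2 - (v + d)\<^sup>2\<close> turns minus
  twice the form into a sum of three squares whose coefficients are nonnegative by the
  assumptions.\<close>

lemma delay_quadratic_form_nonpos:
  fixes v d \<mu>1 \<mu>2 c :: real
  assumes "0 \<le> \<mu>2" "\<mu>2 \<le> 2 * c" "2 * c \<le> 2 * \<mu>1 - \<mu>2"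
  shows "- \<mu>1 * v\<^sup>2 - \<mu>2 * v * d + c * (v\<^sup>2 - d\<^sup>2) \<le> 0"
proof -
  have "0 \<le> (2 * \<mu>1 - \<mu>2 - 2 * c) * v\<^sup>2" "0 \<le> (2 * c - \<mu>2) * d\<^sup>2" "0 \<le> \<mu>2 * (v + d)\<^sup>2"
    using assms by simp_all
  then show ?thesis
    by (simp add: power2_eq_square algebra_simps)
qed

theorem mainTheorem4:
  fixes N I :: nat
    and dt \<tau> \<xi> \<mu>1 \<mu>2 a0 :: real
    and a b u0 u1 y0 y1 :: "real \<Rightarrow> real"
    and f0 :: "real \<Rightarrow> real \<Rightarrow> real"
    and \<omega> \<omega>b :: "real set"
    and u y :: "nat \<Rightarrow> int \<Rightarrow> real"
  assumes "\<mu>1 > 0" and "\<mu>2 > 0" and "\<xi> > 0"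
    and "dt > 0" and "I \<ge> 1" and "\<tau> = real I * dt"
    and "L_infty a" and "AE x in lebesgue_on Omega. a x \<ge> 0"
    and "\<forall>j\<in>{1..N}. a (node N j) \<ge> 0"
    and "W1_infty b" and "continuous_on {0..1} b"
    and "open \<omega>" and "\<omega> \<noteq> {}" and "\<omega> \<subseteq> Omega" and "geometric_control \<omega>"
    and "a0 > 0" and "AE x in lebesgue_on \<omega>. a x > a0"
    and "open \<omega>b" and "\<omega>b \<noteq> {}" and "\<omega>b \<subseteq> \<omega>" and "\<forall>x\<in>closure \<omega>b. b x \<noteq> 0"
    and "discrete_solution N I dt \<mu>1 \<mu>2 a b u0 u1 y0 y1 f0 u y"
    and "\<mu>2 < \<mu>1" and "\<tau> * \<mu>2 < \<xi>" and "\<xi> < \<tau> * (2 * \<mu>1 - \<mu>2)"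
  shows "\<forall>n\<ge>1. discrete_energy N I dt \<tau> \<xi> a f0 u y n
               \<le> discrete_energy N I dt \<tau> \<xi> a f0 u y (n - 1)"
proof (intro allI impI)
  fix n :: int
  assume n: "n \<ge> 1"
  note pos = \<open>dt > 0\<close>
  have \<tau>: "\<tau> > 0"
    using assms by simp
  let ?E = "discrete_energy N I dt \<tau> \<xi> a f0 u y"
  define A where "A j = a (node N j)" for j
  define v where "v j = centered_dt dt u j n" for j
  define z where "z j = centered_dt dt y j n" for j
  define D where "D j = delay_term N I dt f0 u j n" for j
  define c where "c = \<xi> / (2 * \<tau>)"
  note sol = \<open>discrete_solution N I dt \<mu>1 \<mu>2 a b u0 u1 y0 y1 f0 u y\<close>[unfolded discrete_solution_def]
  have bdry: "u 0 m = 0 \<and> u (N + 1) m = 0 \<and> y 0 m = 0 \<and> y (N + 1) m = 0" if "m \<ge> 0" for m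
    using sol that by blast
  have eqs: "discrete_wave (mesh N) dt u j n + b (node N j) * z j + A j * \<mu>1 * v j
        + A j * \<mu>2 * D j = 0 \<and> discrete_wave (mesh N) dt y j n - b (node N j) * v j = 0"
    if "j \<in> {1..N}" for j
    using sol n that unfolding A_def v_def z_def D_def by auto
  \<comment> \<open>Since \<open>2 * c\<close> is \<xi>/\<tau>, these are the two bounds on \<xi>
    divided by \<tau>.\<close>
  have c: "\<mu>2 \<le> 2 * c" "2 * c \<le> 2 * \<mu>1 - \<mu>2"
    using assms \<tau> by (simp_all add: c_def field_simps)
  \<comment> \<open>As \<open>n \<ge> 1\<close>, the levels \<open>n - 1\<close> and
    \<open>n + 1\<close> are both nonnegative, so the Dirichlet values supply the boundary
    hypotheses for \<open>u\<close> and \<open>y\<close>.\<close>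
  have "?E n - ?E (n - 1) = dt * (\<Sum>j=1..N. discrete_wave (mesh N) dt u j n * v j)
      + dt * (\<Sum>j=1..N. discrete_wave (mesh N) dt y j n * z j)
      + c * dt * (\<Sum>j=1..N. A j * ((v j)\<^sup>2 - (D j)\<^sup>2))"
    using wave_energy_increment[of dt u n N] wave_energy_increment[of dt y n N]
      delay_energy_increment[OF n, of N I dt \<tau> \<xi> a f0 u] bdry[of "n + 1"] bdry[of "n - 1"] pos n
    unfolding discrete_energy_def A_def v_def z_def D_def c_def by simp
  also have "\<dots> = dt * (\<Sum>j=1..N. discrete_wave (mesh N) dt u j n * v j
      + discrete_wave (mesh N) dt y j n * z j + c * (A j * ((v j)\<^sup>2 - (D j)\<^sup>2)))"
    by (simp only: sum.distrib sum_distrib_left[symmetric] distrib_left ac_simps)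
  also have "\<dots> = dt * (\<Sum>j=1..N. A j * (- \<mu>1 * (v j)\<^sup>2 - \<mu>2 * v j * D j + c * ((v j)\<^sup>2 - (D j)\<^sup>2)))"
  proof (intro arg_cong[where f = "\<lambda>s. dt * s"] sum.cong refl)
    fix j assume "j \<in> {1..N}"
    then have wave_u: "discrete_wave (mesh N) dt u j n = - b (node N j) * z j - A j * \<mu>1 * v j - A j * \<mu>2 * D j"
      and wave_y: "discrete_wave (mesh N) dt y j n = b (node N j) * v j"
      using eqs[of j] by linarith+
    \<comment> \<open>The coupling contributes \<open>- b (node N j) * z j * v j\<close> from the
      first equation and its opposite from the second.\<close>
    show "discrete_wave (mesh N) dt u j n * v j + discrete_wave (mesh N) dt y j n * z j
        + c * (A j * ((v j)\<^sup>2 - (D j)\<^sup>2))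
        = A j * (- \<mu>1 * (v j)\<^sup>2 - \<mu>2 * v j * D j + c * ((v j)\<^sup>2 - (D j)\<^sup>2))"
      unfolding wave_u wave_y by (simp add: power2_eq_square algebra_simps)
  qed
  also have "\<dots> \<le> 0"
  proof (intro mult_nonneg_nonpos sum_nonpos)
    show "A j \<ge> 0" if "j \<in> {1..N}" for j
      using \<open>\<forall>j\<in>{1..N}. a (node N j) \<ge> 0\<close> that by (simp add: A_def)
    show "- \<mu>1 * (v j)\<^sup>2 - \<mu>2 * v j * D j + c * ((v j)\<^sup>2 - (D j)\<^sup>2) \<le> 0" for j
      using delay_quadratic_form_nonpos c \<open>\<mu>2 > 0\<close> by (simp only: less_imp_le)
  qed (use pos in simp)
  finally show "?E n \<le> ?E (n - 1)" by simp
qed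

end
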